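(* Let $r\ge 1$ be an integer and let $\mathcal{H}$ be an $r$-uniform hypergraph on $n$ vertices. If $e(\mathcal{H})>n$, then $\mathcal{H}$ contains a Berge path of length at least $r+1$.
   Context: A hypergraph $\mathcal{H}$ consists of a finite vertex set $V(\mathcal{H})$ and a set $E(\mathcal{H})$ of distinct subsets of $V(\mathcal{H})$ (hyperedges; no repeated hyperedges); $n=n(\mathcal{H})=|V(\mathcal{H})|$ and $e(\mathcal{H})=|E(\mathcal{H})|$. It is $r$-uniform if every hyperedge has exactly $r$ vertices. A Berge path of length $k$ is a collection of $k$ distinct hyperedges $e_1,\dots,e_k$ and $k+1$ distinct vertices $v_1,\dots,v_{k+1}$ such that $v_i,v_{i+1}\in e_i$ for each $1\le i\le k$. *)

theory Defs
  imports Main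
begin

definition hypergraph :: "'a set \<Rightarrow> 'a set set \<Rightarrow> bool" where
  "hypergraph V E \<longleftrightarrow> finite V \<and> E \<subseteq> Pow V"

definition uniform :: "nat \<Rightarrow> 'a set set \<Rightarrow> bool" where
  "uniform r E \<longleftrightarrow> (\<forall>e\<in>E. card e = r)"

text \<open>
  A Berge path of length \<open>k\<close> with hyperedges \<open>es\<close> and vertices \<open>vs\<close>. List positions count
  from 0, so \<open>es ! i\<close> and \<open>vs ! i\<close> are the usual \<open>e\<^sub>i\<^sub>+\<^sub>1\<close> and \<open>v\<^sub>i\<^sub>+\<^sub>1\<close>.
\<close>

definition berge_path ::
  "'a set \<Rightarrow> 'a set set \<Rightarrow> nat \<Rightarrow> 'a set list \<Rightarrow> 'a list \<Rightarrow> bool" where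
  "berge_path V E k es vs \<longleftrightarrow>
     length es = k \<and> distinct es \<and> set es \<subseteq> E \<and>
     length vs = k + 1 \<and> distinct vs \<and> set vs \<subseteq> V \<and>
     (\<forall>i<k. vs ! i \<in> es ! i \<and> vs ! (i + 1) \<in> es ! i)"

end

theory Submission
  imports Defs
begin

text \<open>
  In a counterexample with \<open>n\<close> minimal every nonempty set \<open>S\<close> of vertices meets more than \<open>|S|\<close>
  hyperedges, so by Hall's theorem there is an injection \<open>\<phi>\<close> assigning to each vertex a hyperedge
  containing it. Consider a longest path \<open>v\<^sub>1, v\<^sub>2, \<dots>\<close> with \<open>v\<^sub>i\<^sub>+\<^sub>1 \<in> \<phi> v\<^sub>i\<close>. If \<open>v\<close> is its last vertex, then
  \<open>\<phi> v\<close> lies on the path, which closes up to a Berge cycle \<open>C\<close> of length \<open>m \<ge> r\<close>. If \<open>m \<ge> r + 2\<close>, it contains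
  the required path. If \<open>m = r + 1\<close>, some hyperedge meeting \<open>C\<close> leaves \<open>C\<close>, since \<open>C\<close> contains only
  \<open>r + 1\<close> sets of size \<open>r\<close>, and the cycle opens up to a path through this hyperedge. If \<open>m = r\<close>, then
  \<open>\<phi> v = C\<close>, so for the first two vertices \<open>a, b\<close> of \<open>C\<close> in path order \<open>\<phi> a\<close> contains a vertex \<open>u \<notin> C\<close>.
  Then there are Berge paths of length \<open>r\<close> on \<open>C \<union> {u}\<close> from \<open>u\<close> to \<open>a\<close> and from \<open>u\<close> to \<open>b\<close>. Either \<open>\<phi> u\<close>
  prolongs the first, or \<open>\<phi> u\<close> omits a single vertex of \<open>C\<close> and hence closes one of them to a cycle of
  length \<open>r + 1\<close>.
\<close>

section \<open>Hall's theorem\<close>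

text \<open>Induction on \<open>card I\<close>. If every nonempty proper subfamily has strict
  surplus, one index may take any \<open>x\<close>, since removing \<open>x\<close> costs each other
  union at most one element. Otherwise a tight \<open>J\<close> is matched inside its union and the
  other indices outside it.\<close>

lemma hall:
  fixes A :: "'i \<Rightarrow> 'b set"
  assumes "finite I" and "\<And>i. i \<in> I \<Longrightarrow> finite (A i)"
    and "\<And>J. J \<subseteq> I \<Longrightarrow> card J \<le> card (\<Union>(A ` J))"
  shows "\<exists>f. inj_on f I \<and> (\<forall>i\<in>I. f i \<in> A i)"
  using assms
proof (induction "card I" arbitrary: I A rule: less_induct)
  case less
  note fin = less.prems(1,2) and hallc = less.prems(3)
  show ?case
  proof (cases "I = {}")
    case False
    then obtain i where i: "i \<in> I" by blast
    show ?thesis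
    proof (cases "\<forall>J. J \<subset> I \<longrightarrow> J \<noteq> {} \<longrightarrow> card J < card (\<Union>(A ` J))")
      case strict: True
      have "card {i} \<le> card (\<Union>(A ` {i}))" using hallc[of "{i}"] i by blast
      then obtain x where x: "x \<in> A i" by fastforce
      let ?B = "\<lambda>j. A j - {x}"
      have "\<exists>f. inj_on f (I - {i}) \<and> (\<forall>j\<in>I - {i}. f j \<in> ?B j)"
      proof (rule less.hyps)
        show "card (I - {i}) < card I" using i fin(1) by (rule card_Diff1_less[rotated])
        show "finite (I - {i})" using fin by simp
        show "finite (?B j)" if "j \<in> I - {i}" for j using fin that by simp
        show "card J \<le> card (\<Union>(?B ` J))" if J: "J \<subseteq> I - {i}" for J
        proof (cases "J = {}")
          case False
          then have "card J < card (\<Union>(A ` J))" using strict J i by blast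
          moreover have "\<Union>(?B ` J) = \<Union>(A ` J) - {x}" by blast
          ultimately show ?thesis by (auto simp: card_Diff_singleton_if)
        qed simp
      qed
      then obtain f where f: "inj_on f (I - {i})" "\<forall>j\<in>I - {i}. f j \<in> ?B j" by blast
      then have "inj_on (f(i := x)) I" unfolding inj_on_def by auto
      moreover have "\<forall>j\<in>I. (f(i := x)) j \<in> A j" using f x by auto
      ultimately show ?thesis by blast
    next
      case False
      then obtain J where J: "J \<subset> I" "J \<noteq> {}" "card (\<Union>(A ` J)) \<le> card J"
        by (meson not_less)
      let ?U = "\<Union>(A ` J)"
      let ?B = "\<lambda>j. A j - ?U"
      have finJ: "finite J" using J fin finite_subset by blast
      have finU: "finite ?U" using J fin finJ by blast
      have "\<exists>f. inj_on f J \<and> (\<forall>j\<in>J. f j \<in> A j)"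
      proof (rule less.hyps)
        show "card J < card I" using J fin by (simp add: psubset_card_mono)
      qed (use J fin finJ hallc in \<open>auto simp: psubset_eq\<close>)
      then obtain f where f: "inj_on f J" "\<forall>j\<in>J. f j \<in> A j" by blast
      have "\<exists>g. inj_on g (I - J) \<and> (\<forall>j\<in>I - J. g j \<in> ?B j)"
      proof (rule less.hyps)
        show "card (I - J) < card I" using J fin by (intro psubset_card_mono) auto
        show "finite (I - J)" using fin by simp
        show "finite (?B j)" if "j \<in> I - J" for j using fin that by simp
        show "card K \<le> card (\<Union>(?B ` K))" if K: "K \<subseteq> I - J" for K
        proof -
          have finK: "finite K" using K fin finite_subset by blast
          have finB: "finite (\<Union>(?B ` K))" using K fin finK by auto
          \<comment> \<open>Hall's condition for \<open>J \<union> K\<close> yields that for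
            \<open>K\<close> outside \<open>?U\<close>, because tightness of \<open>J\<close> lets
            its share be cancelled.\<close>
          have "card J + card K = card (J \<union> K)"
            using K finJ finK by (intro card_Un_disjoint[symmetric]) auto
          also have "\<dots> \<le> card (\<Union>(A ` (J \<union> K)))" using hallc[of "J \<union> K"] J K by blast
          also have "\<Union>(A ` (J \<union> K)) = ?U \<union> \<Union>(?B ` K)" by blast
          also have "card \<dots> = card ?U + card (\<Union>(?B ` K))"
            using finU finB by (intro card_Un_disjoint) auto
          finally show ?thesis using J(3) by linarith
        qed
      qed
      then obtain g where g: "inj_on g (I - J)" "\<forall>j\<in>I - J. g j \<in> ?B j" by blast
      have sep: "f a \<noteq> g b" if "a \<in> J" "b \<in> I - J" for a b
        using that f(2) g(2) by (metis DiffD2 UN_I)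
      let ?h = "\<lambda>j. if j \<in> J then f j else g j"
      have "inj_on ?h I"
      proof (rule inj_onI)
        fix a b assume ab: "a \<in> I" "b \<in> I" "?h a = ?h b"
        show "a = b"
          using ab f(1) g(1) sep[of a b] sep[of b a]
          by (cases "a \<in> J"; cases "b \<in> J") (auto dest: inj_onD)
      qed
      moreover have "\<forall>j\<in>I. ?h j \<in> A j" using f g by auto
      ultimately show ?thesis by blast
    qed
  qed simp
qed

section \<open>Berge paths and cycles\<close>

lemma berge_path_mono:
  assumes "berge_path V E k es vs" "V \<subseteq> V'" "E \<subseteq> E'"
  shows "berge_path V' E' k es vs"
  using assms unfolding berge_path_def by blast

lemma berge_path_Cons:
  assumes "berge_path V E k es vs"
    and "e \<in> E" "e \<notin> set es" "v \<in> V" "v \<notin> set vs" "v \<in> e" "hd vs \<in> e"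
  shows "berge_path V E (Suc k) (e # es) (v # vs)"
proof -
  have "vs \<noteq> []" using assms(1) by (auto simp: berge_path_def)
  then show ?thesis
    using assms by (auto simp: berge_path_def All_less_Suc2 hd_conv_nth)
qed

text \<open>Degenerate lengths are allowed: for \<open>m = 1\<close> the wrap-around sends the only
  vertex to itself.\<close>

definition berge_cycle :: "'a set \<Rightarrow> 'a set set \<Rightarrow> nat \<Rightarrow> 'a set list \<Rightarrow> 'a list \<Rightarrow> bool" where
  "berge_cycle V E m es vs \<longleftrightarrow>
     length es = m \<and> distinct es \<and> set es \<subseteq> E \<and>
     length vs = m \<and> distinct vs \<and> set vs \<subseteq> V \<and>
     (\<forall>i<m. vs ! i \<in> es ! i \<and> vs ! (Suc i mod m) \<in> es ! i)"

lemma berge_cycle_rotate: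
  assumes "berge_cycle V E m es vs"
  shows "berge_cycle V E m (rotate k es) (rotate k vs)"
proof -
  have "rotate k vs ! i \<in> rotate k es ! i \<and> rotate k vs ! (Suc i mod m) \<in> rotate k es ! i"
    if "i < m" for i
  proof -
    let ?j = "(k + i) mod m"
    have "?j < m" using that by simp
    moreover have "(k + Suc i mod m) mod m = Suc ?j mod m" by (simp add: mod_simps)
    moreover have "Suc i mod m < m" using that by simp
    ultimately show ?thesis
      using assms that by (simp add: berge_cycle_def nth_rotate)
  qed
  then show ?thesis using assms by (simp add: berge_cycle_def)
qed

lemma berge_path_of_cycle:
  assumes "berge_cycle V E (Suc k) es vs"
  shows "berge_path V E k (butlast es) vs"
proof -
  have "vs ! i \<in> butlast es ! i \<and> vs ! (i + 1) \<in> butlast es ! i" if "i < k" for i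
  proof -
    have "vs ! i \<in> es ! i \<and> vs ! (Suc i mod Suc k) \<in> es ! i"
      using assms that unfolding berge_cycle_def by (metis less_SucI)
    moreover have "Suc i mod Suc k = i + 1" using that by simp
    moreover have "butlast es ! i = es ! i"
      using assms that by (simp add: berge_cycle_def nth_butlast)
    ultimately show ?thesis by simp
  qed
  then show ?thesis
    using assms by (auto simp: berge_cycle_def berge_path_def distinct_butlast dest: in_set_butlastD)
qed

lemma berge_cycle_of_path:
  assumes "berge_path V E k es vs"
    and "e \<in> E" "e \<notin> set es" "hd vs \<in> e" "last vs \<in> e"
  shows "berge_cycle V E (Suc k) (es @ [e]) vs"
proof -
  have len: "length es = k" "length vs = Suc k" using assms(1) by (auto simp: berge_path_def)
  then have "vs \<noteq> []" by auto
  then have "vs ! 0 \<in> e" "vs ! k \<in> e" using assms len by (auto simp: hd_conv_nth last_conv_nth)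
  moreover have "vs ! i \<in> es ! i" "vs ! (Suc i mod Suc k) \<in> es ! i" if "i < k" for i
    using assms(1) that by (simp_all add: berge_path_def)
  ultimately have "\<forall>i<Suc k. vs ! i \<in> (es @ [e]) ! i \<and> vs ! (Suc i mod Suc k) \<in> (es @ [e]) ! i"
    using len by (simp add: All_less_Suc nth_append)
  then show ?thesis using assms by (auto simp: berge_path_def berge_cycle_def)
qed

text \<open>Dropping the closing hyperedge costs one and attaching \<open>w\<close> through
  \<open>f\<close> regains it. If \<open>f\<close> lies on the cycle already, the rotation is chosen
  so that \<open>f\<close> is the one dropped.\<close>

lemma berge_cycle_opens_up:
  assumes cyc: "berge_cycle V E m es vs"
    and f: "f \<in> E" "x \<in> f" "x \<in> set vs" "w \<in> f" "w \<in> V" "w \<notin> set vs"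
  shows "\<exists>es' vs'. berge_path V E m es' vs'"
proof -
  have "vs \<noteq> []" using f by auto
  then obtain k where m: "m = Suc k"
    using cyc by (cases m) (auto simp: berge_cycle_def)
  have len: "length es = m" "length vs = m" using cyc by (auto simp: berge_cycle_def)
  have "\<exists>j<m. vs ! j \<in> f \<and> f \<notin> set (butlast (rotate j es))"
  proof (cases "f \<in> set es")
    case False
    obtain j where "j < m" "vs ! j = x" using f len by (metis in_set_conv_nth)
    then show ?thesis using f False by (metis in_set_butlastD set_rotate)
  next
    case True
    then obtain i where i: "i < m" "es ! i = f" using len by (metis in_set_conv_nth)
    \<comment> \<open>Starting just after position \<open>i\<close> moves \<open>f\<close> to the
      end, where \<open>butlast\<close> removes it, and the new first vertex still lies in
      \<open>f\<close>.\<close>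
    let ?j = "Suc i mod m"
    have "rotate ?j es \<noteq> []" using len m by auto
    then have "last (rotate ?j es) = rotate ?j es ! k" using len m by (simp add: last_conv_nth)
    also have "\<dots> = es ! ((?j + k) mod m)" using len m by (simp add: nth_rotate)
    also have "(?j + k) mod m = (i + m) mod m" using m by (simp add: mod_simps)
    finally have "last (rotate ?j es) = f" using i by simp
    moreover have "distinct (rotate ?j es)" using cyc by (simp add: berge_cycle_def)
    ultimately have "f \<notin> set (butlast (rotate ?j es))"
      using \<open>rotate ?j es \<noteq> []\<close>
      by (metis append_butlast_last_id distinct_butlast not_distinct_conv_prefix)
    moreover have "?j < m" using m by simp
    moreover have "vs ! ?j \<in> f" using cyc i by (auto simp: berge_cycle_def)
    ultimately show ?thesis by blast
  qed
  then obtain j where j: "j < m" "vs ! j \<in> f" "f \<notin> set (butlast (rotate j es))" by blast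
  have "berge_path V E k (butlast (rotate j es)) (rotate j vs)"
    using berge_path_of_cycle berge_cycle_rotate cyc m by blast
  moreover have "hd (rotate j vs) \<in> f" using j len
    by (metis hd_rotate_conv_nth less_nat_zero_code list.size(3) mod_less)
  ultimately have "berge_path V E (Suc k) (f # butlast (rotate j es)) (w # rotate j vs)"
    using f j by (intro berge_path_Cons) auto
  then show ?thesis using m by blast
qed

text \<open>The cycle spans only \<open>r + 1\<close> sets of size \<open>r\<close>, fewer than the hyperedges meeting it.\<close>

lemma long_path_of_cycle:
  assumes hyp: "hypergraph V E" "uniform r E"
    and surplus: "\<And>S. S \<subseteq> V \<Longrightarrow> S \<noteq> {} \<Longrightarrow> card S < card {e \<in> E. e \<inter> S \<noteq> {}}"
    and cyc: "berge_cycle V E (r + 1) es vs"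
  shows "\<exists>es' vs'. berge_path V E (r + 1) es' vs'"
proof -
  let ?C = "set vs"
  have C: "?C \<subseteq> V" "card ?C = r + 1"
    using cyc by (auto simp: berge_cycle_def distinct_card)
  then have "?C \<noteq> {}" by (metis Suc_eq_plus1 card.empty nat.distinct(1))
  then have "r + 1 < card {e \<in> E. e \<inter> ?C \<noteq> {}}" using surplus[of ?C] C by simp
  moreover have "card {B. B \<subseteq> ?C \<and> card B = r} = r + 1"
    using C by (simp add: n_subsets del: set_empty)
  moreover have "finite {B. B \<subseteq> ?C \<and> card B = r}" by simp
  ultimately have "\<not> {e \<in> E. e \<inter> ?C \<noteq> {}} \<subseteq> {B. B \<subseteq> ?C \<and> card B = r}"
    using card_mono[of "{B. B \<subseteq> ?C \<and> card B = r}" "{e \<in> E. e \<inter> ?C \<noteq> {}}"] by linarith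
  then obtain f x w where "f \<in> E" "x \<in> f" "x \<in> ?C" "w \<in> f" "w \<notin> ?C"
    using hyp by (auto simp: uniform_def)
  moreover from this have "w \<in> V" using hyp by (auto simp: hypergraph_def)
  ultimately show ?thesis using berge_cycle_opens_up[OF cyc] by blast
qed

section \<open>The functional digraph of a system of distinct representatives\<close>

text \<open>A longest path in the digraph with arcs \<open>v \<rightarrow> w\<close> for \<open>w \<in> \<phi> v\<close> closes up at its last vertex.\<close>

lemma representative_cycle:
  assumes V: "finite V" "V \<noteq> {}"
    and \<phi>: "inj_on \<phi> V" "\<And>v. v \<in> V \<Longrightarrow> \<phi> v \<in> E" "\<And>v. v \<in> V \<Longrightarrow> v \<in> \<phi> v"
    and E: "\<And>e. e \<in> E \<Longrightarrow> e \<subseteq> V"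
  shows "\<exists>cs. cs \<noteq> [] \<and> berge_cycle V E (length cs) (map \<phi> cs) cs \<and> \<phi> (last cs) \<subseteq> set cs"
proof -
  let ?P = "\<lambda>vs. vs \<noteq> [] \<and> distinct vs \<and> set vs \<subseteq> V \<and>
    (\<forall>i. Suc i < length vs \<longrightarrow> vs ! Suc i \<in> \<phi> (vs ! i))"
  obtain v where "v \<in> V" using V by blast
  then have "?P [v]" by simp
  moreover have "\<forall>vs. ?P vs \<longrightarrow> length vs < Suc (card V)"
    using V by (metis card_mono distinct_card less_Suc_eq_le)
  ultimately have "\<exists>vs. ?P vs \<and> (\<forall>ws. ?P ws \<longrightarrow> length ws \<le> length vs)"
    by (rule ex_has_greatest_nat)
  then obtain vs where vs: "?P vs" and max: "\<And>ws. ?P ws \<Longrightarrow> length ws \<le> length vs"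
    by blast
  have lastV: "last vs \<in> V" using vs by auto
  have sub: "\<phi> (last vs) \<subseteq> set vs"
  proof
    fix w assume w: "w \<in> \<phi> (last vs)"
    show "w \<in> set vs"
    proof (rule ccontr)
      assume "w \<notin> set vs"
      moreover have "w \<in> V" using w lastV E \<phi> by blast
      moreover have "(vs @ [w]) ! Suc i \<in> \<phi> ((vs @ [w]) ! i)" if "Suc i < length (vs @ [w])" for i
      proof (cases "Suc i < length vs")
        case False
        then have "i = length vs - 1" using that by simp
        then show ?thesis using vs w by (auto simp: nth_append last_conv_nth)
      qed (use vs in \<open>auto simp: nth_append\<close>)
      ultimately have "?P (vs @ [w])" using vs by simp
      from max[OF this] show False by simp
    qed
  qed
  let ?Q = "\<lambda>j. j < length vs \<and> vs ! j \<in> \<phi> (last vs)"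
  \<comment> \<open>Cutting at the earliest vertex of \<open>\<phi> (last vs)\<close> keeps all of
    that hyperedge on the cycle; this later bounds the length below by \<open>r\<close>.\<close>
  define j where "j = (LEAST j. ?Q j)"
  have "?Q (length vs - 1)" using vs lastV \<phi> by (simp add: last_conv_nth)
  then have j: "?Q j" unfolding j_def by (rule LeastI)
  have least: "j \<le> i" if "?Q i" for i unfolding j_def using that by (rule Least_le)
  let ?cs = "drop j vs"
  have ne: "?cs \<noteq> []" and last: "last ?cs = last vs" using j by auto
  have "\<phi> (last vs) \<subseteq> set ?cs"
  proof
    fix w assume w: "w \<in> \<phi> (last vs)"
    then obtain i where "i < length vs" "vs ! i = w" using sub by (metis in_set_conv_nth subsetD)
    moreover from this have "j \<le> i" using w least by blast
    ultimately show "w \<in> set ?cs"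
      by (auto simp: in_set_conv_nth intro!: exI[of _ "i - j"])
  qed
  moreover have "berge_cycle V E (length ?cs) (map \<phi> ?cs) ?cs"
    unfolding berge_cycle_def
  proof (intro conjI allI impI)
    have sV: "set ?cs \<subseteq> V" using vs set_drop_subset by fastforce
    show "set ?cs \<subseteq> V" by fact
    show "distinct ?cs" using vs by simp
    show "distinct (map \<phi> ?cs)"
      using \<open>distinct ?cs\<close> sV \<phi>(1) inj_on_subset by (auto simp: distinct_map)
    show "set (map \<phi> ?cs) \<subseteq> E" using sV \<phi>(2) by auto
    fix i assume i: "i < length ?cs"
    then have "?cs ! i \<in> V" using sV nth_mem by blast
    then show "?cs ! i \<in> map \<phi> ?cs ! i" using i \<phi>(3) by simp
    show "?cs ! (Suc i mod length ?cs) \<in> map \<phi> ?cs ! i"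
    proof (cases "Suc i = length ?cs")
      case True
      then have "?cs ! i = last vs" using ne last by (metis diff_Suc_1 last_conv_nth)
      then show ?thesis using True i j by simp
    next
      case False
      then show ?thesis using i vs by simp
    qed
  qed simp_all
  ultimately show ?thesis using ne last by (intro exI[of _ ?cs]) simp
qed

text \<open>This is the case in which no vertex set can be deleted. Surplus serves twice: for Hall's
  condition and, through \<open>long_path_of_cycle\<close>, for cycles of length
  \<open>r + 1\<close>.\<close>

lemma long_path_of_surplus:
  assumes r: "r \<ge> 1" and hyp: "hypergraph V E" "uniform r E" and ne: "V \<noteq> {}"
    and surplus: "\<And>S. S \<subseteq> V \<Longrightarrow> S \<noteq> {} \<Longrightarrow> card S < card {e \<in> E. e \<inter> S \<noteq> {}}"
  shows "\<exists>k es vs. k \<ge> r + 1 \<and> berge_path V E k es vs"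
proof -
  have V: "finite V" and E: "\<And>e. e \<in> E \<Longrightarrow> e \<subseteq> V" using hyp by (auto simp: hypergraph_def)
  have cardE: "\<And>e. e \<in> E \<Longrightarrow> card e = r" using hyp by (simp add: uniform_def)
  have finE: "finite E" using V E by (meson finite_Pow_iff finite_subset PowI subsetI)
  have "\<exists>\<phi>. inj_on \<phi> V \<and> (\<forall>v\<in>V. \<phi> v \<in> {e \<in> E. v \<in> e})"
  proof (rule hall)
    show "card J \<le> card (\<Union>v\<in>J. {e \<in> E. v \<in> e})" if "J \<subseteq> V" for J
    proof (cases "J = {}")
      case False
      have "(\<Union>v\<in>J. {e \<in> E. v \<in> e}) = {e \<in> E. e \<inter> J \<noteq> {}}" by blast
      then show ?thesis using surplus[OF that False] by simp
    qed simp
  qed (use V finE in auto)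
  then obtain \<phi> where \<phi>: "inj_on \<phi> V" "\<And>v. v \<in> V \<Longrightarrow> \<phi> v \<in> E" "\<And>v. v \<in> V \<Longrightarrow> v \<in> \<phi> v"
    by blast
  obtain cs where cs: "cs \<noteq> []" "berge_cycle V E (length cs) (map \<phi> cs) cs"
    and sub: "\<phi> (last cs) \<subseteq> set cs"
    using representative_cycle[OF V ne \<phi> E] by blast
  have dist: "distinct cs" and csV: "set cs \<subseteq> V" using cs by (auto simp: berge_cycle_def)
  have "r \<le> length cs"
    using card_mono[OF _ sub] cardE[of "\<phi> (last cs)"] \<phi> csV cs(1) dist
    by (metis List.finite_set distinct_card last_in_set subsetD)
  then consider "length cs = r" | "length cs = r + 1" | "length cs \<ge> r + 2" by linarith
  then show ?thesis
  proof cases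
    case 3
    then obtain k where "length cs = Suc k" "k \<ge> r + 1"
      by (metis Suc_le_D Suc_le_mono add_2_eq_Suc' Suc_eq_plus1)
    then show ?thesis using berge_path_of_cycle cs(2) by metis
  next
    case 2
    then show ?thesis using long_path_of_cycle[OF hyp surplus] cs(2) by (metis order_refl)
  next
    case 1
    have lastV: "last cs \<in> V" using cs csV by auto
    have C: "\<phi> (last cs) = set cs"
      using sub 1 dist cardE[OF \<phi>(2)[OF lastV]] by (intro card_subset_eq) (auto simp: distinct_card)
    \<comment> \<open>For \<open>r = 1\<close> the cycle has no second vertex \<open>b\<close>; but
      then \<open>{?v}\<close> is the only possible hyperedge through \<open>?v\<close>, against
      surplus.\<close>
    have "r \<noteq> 1"
    proof
      assume "r = 1"
      let ?v = "last cs"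
      have "{e \<in> E. e \<inter> {?v} \<noteq> {}} \<subseteq> {{?v}}"
        using cardE \<open>r = 1\<close> by (auto simp: card_1_singleton_iff)
      then have "card {e \<in> E. e \<inter> {?v} \<noteq> {}} \<le> 1"
        by (metis card_mono finite.intros is_singletonI is_singleton_altdef)
      then show False using surplus[of "{?v}"] lastV by simp
    qed
    then obtain a b bs where ab: "cs = a # b # bs" 
      using r 1 by (cases cs; cases "tl cs") auto
    have abV: "a \<in> V" "b \<in> V" using csV ab by auto
    have "a \<noteq> last cs" using ab dist by auto
    then have "\<phi> a \<noteq> set cs" using C \<phi>(1) abV lastV by (metis inj_onD)
    then have "\<not> \<phi> a \<subseteq> set cs"
      using 1 dist cardE[OF \<phi>(2)[OF abV(1)]] by (metis List.finite_set card_subset_eq distinct_card)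
    then obtain u where u: "u \<in> \<phi> a" "u \<notin> set cs" by blast
    have uV: "u \<in> V" using u E \<phi> abV by blast
    have \<phi>u: "\<phi> u \<in> E" "u \<in> \<phi> u" "\<phi> u \<notin> set (map \<phi> cs)"
      using \<phi> uV u csV by (auto dest: inj_onD)
    \<comment> \<open>Rotation by one makes \<open>\<phi> a\<close> the closing hyperedge. Without
      it a path from \<open>b\<close> to \<open>a\<close> remains, and \<open>\<phi> a\<close> or
      \<open>\<phi> u\<close> can be put in front.\<close>
    have rot: "berge_path V E (r - 1) (map \<phi> (b # bs)) (b # bs @ [a])"
      using berge_path_of_cycle[of V E "r - 1" "rotate 1 (map \<phi> cs)" "rotate 1 cs"]
        berge_cycle_rotate[OF cs(2), of 1] 1 r ab by simp
    have "berge_path V E (Suc (r - 1)) (\<phi> a # map \<phi> (b # bs)) (u # b # bs @ [a])"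
    proof (rule berge_path_Cons[OF rot])
      show "\<phi> a \<notin> set (map \<phi> (b # bs))" using cs(2) ab by (auto simp: berge_cycle_def)
      show "hd (b # bs @ [a]) \<in> \<phi> a" using cs(2) ab by (auto simp: berge_cycle_def)
    qed (use \<phi> abV u uV ab in auto)
    then have path1: "berge_path V E r (map \<phi> cs) (u # b # bs @ [a])" using ab r by simp
    show ?thesis
    proof (cases "\<phi> u \<subseteq> insert u (set cs)")
      case False
      then obtain w where w: "w \<in> \<phi> u" "w \<notin> insert u (set cs)" by blast
      then have "w \<in> V" using \<phi>u E by blast
      then have "berge_path V E (Suc r) (\<phi> u # map \<phi> cs) (w # u # b # bs @ [a])"
        using \<phi>u w ab by (intro berge_path_Cons[OF path1]) auto
      then show ?thesis by (metis Suc_eq_plus1 order_refl)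
    next
      case True
      \<comment> \<open>Missing both would confine \<open>\<phi> u\<close> to \<open>u\<close> and
        the \<open>r - 2\<close> vertices of \<open>bs\<close>, too few for size
        \<open>r\<close>.\<close>
      have "a \<in> \<phi> u \<or> b \<in> \<phi> u"
      proof (rule ccontr)
        assume "\<not> ?thesis"
        then have "\<phi> u \<subseteq> insert u (set bs)" using True ab by auto
        then have "card (\<phi> u) \<le> card (insert u (set bs))" by (intro card_mono) auto
        also have "\<dots> \<le> Suc (length bs)"
          by (metis card_length le_SucI Suc_le_mono card_insert_if List.finite_set)
        finally show False using cardE[OF \<phi>u(1)] 1 ab by simp
      qed
      then have "\<exists>es vs. berge_cycle V E (Suc r) es vs"
      proof
        assume "a \<in> \<phi> u"
        then show ?thesis using berge_cycle_of_path[OF path1 \<phi>u(1,3)] \<phi>u(2) by auto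
      next
        assume "b \<in> \<phi> u"
        \<comment> \<open>Here \<open>\<phi> u\<close> takes over the link from \<open>u\<close> to
          \<open>b\<close>, which frees \<open>\<phi> a\<close> to close the cycle between
          \<open>a\<close> and \<open>u\<close>.\<close>
        then have "berge_path V E (Suc (r - 1)) (\<phi> u # map \<phi> (b # bs)) (u # b # bs @ [a])"
          using \<phi>u uV u ab by (intro berge_path_Cons[OF rot]) auto
        then have "berge_path V E r (\<phi> u # map \<phi> (b # bs)) (u # b # bs @ [a])" using r by simp
        moreover have "\<phi> a \<notin> set (\<phi> u # map \<phi> (b # bs))"
          using cs(2) ab \<phi>u(3) by (auto simp: berge_cycle_def)
        ultimately show ?thesis
          using berge_cycle_of_path[of V E r "\<phi> u # map \<phi> (b # bs)" _ "\<phi> a"] \<phi> abV u(1) by fastforce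
      qed
      then show ?thesis using long_path_of_cycle[OF hyp surplus] by (metis Suc_eq_plus1 order_refl)
    qed
  qed
qed

text \<open>Strong induction replaces the minimal counterexample: if some nonempty \<open>S\<close>
  meets at most \<open>card S\<close> hyperedges, deleting both preserves the excess of hyperedges
  over vertices.\<close>

theorem theorem2:
  fixes V :: "'a set" and E :: "'a set set" and r n :: nat
  assumes "r \<ge> 1"
    and "hypergraph V E"
    and "uniform r E"
    and "card V = n"
    and "card E > n"
  shows "\<exists>k es vs. k \<ge> r + 1 \<and> berge_path V E k es vs"
  using assms
proof (induction n arbitrary: V E rule: less_induct)
  case (less n)
  have V: "finite V" and E: "E \<subseteq> Pow V" using less.prems by (auto simp: hypergraph_def)
  have finE: "finite E" using V E finite_subset by blast
  show ?case
  proof (cases "\<exists>S. S \<subseteq> V \<and> S \<noteq> {} \<and> card {e \<in> E. e \<inter> S \<noteq> {}} \<le> card S")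
    case True
    then obtain S where S: "S \<subseteq> V" "S \<noteq> {}" "card {e \<in> E. e \<inter> S \<noteq> {}} \<le> card S" by blast
    \<comment> \<open>Hyperedges meeting \<open>S\<close> are removed entirely rather than
      truncated, so uniformity survives and a path found here is one in the original.\<close>
    let ?V = "V - S" and ?E = "E - {e \<in> E. e \<inter> S \<noteq> {}}"
    have "finite S" using S V finite_subset by blast
    then have cV: "card ?V = n - card S" "0 < card S" "card S \<le> n"
      using S V less.prems by (auto simp: card_Diff_subset card_gt_0_iff card_mono)
    have "card ?E = card E - card {e \<in> E. e \<inter> S \<noteq> {}}" using finE by (intro card_Diff_subset) auto
    then have "card ?E > card ?V" using cV S less.prems by linarith
    moreover have "hypergraph ?V ?E" "uniform r ?E"
      using E V less.prems by (auto simp: hypergraph_def uniform_def)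
    moreover have "card ?V < n" using cV by linarith
    ultimately obtain k es vs where "k \<ge> r + 1" "berge_path ?V ?E k es vs"
      using less.IH[of "card ?V" ?V ?E] less.prems(1) by blast
    then show ?thesis using berge_path_mono[of ?V ?E k es vs V E] by blast
  next
    case False
    have "V \<noteq> {}"
    proof
      assume "V = {}"
      then have "E \<subseteq> {{}}" using E by simp
      moreover have "{} \<notin> E" using less.prems by (auto simp: uniform_def)
      ultimately have "E = {}" by blast
      then show False using less.prems by simp
    qed
    then show ?thesis
      using False less.prems by (intro long_path_of_surplus) (auto simp: not_le)
  qed
qed

end
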